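(* For every fixed $p\in(0,1)$, there is a constant $c_p>0$ such that $$\operatorname{FR}_{\min}(G(N,p))\geq c_pN$$ with probability $1-o(1)$ as $N\to\infty$.
   Context: $G(N,p)$ is the Erdős–Rényi random graph on the labeled vertex set $[N]=\{1,\dots,N\}$, in which each of the $\binom N2$ possible edges is present independently with probability $p$. A vertex labeling of a graph $G=(V,E)$ of order $N=|V|$ is a bijection $\sigma:V\to\mathbb Z_N=\mathbb Z/N\mathbb Z$. The adjacency matrix under $\sigma$ is the $N\times N$ matrix $A_\sigma$, indexed by $\mathbb Z_N\times\mathbb Z_N$, with $(A_\sigma)_{x,y}=1$ if the vertices labeled $x$ and $y$ are adjacent and $0$ otherwise. $F$ is the unitary Fourier matrix $F_{mx}=\frac1{\sqrt N}e^{-2\pi i mx/N}$. The Fourier ratio of a nonzero $N\times N$ matrix $M$ is $\operatorname{FR}(M)=\|FMF\|_1/\|FMF\|_2$, where $\|\cdot\|_1$ is the entrywise $\ell^1$-norm and $\|\cdot\|_2$ the Frobenius norm. The edge complexity of a graph with at least one edge is $\operatorname{FR}_{\min}(G)=\min_\sigma\operatorname{FR}(A_\sigma)$, the minimum over all vertex labelings. It is defined only for graphs with at least one edge; the event in the claim is understood to include that $G(N,p)$ has at least one edge. *)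

theory Defs
  imports "HOL-Probability.Product_PMF" "Jordan_Normal_Form.Matrix"
begin

text \<open>
  Residues modulo \<open>N\<close> are represented by \<open>0, \<dots>, N - 1\<close>, the index range of an
  \<open>N \<times> N\<close> matrix. A graph is given by a finite vertex set \<open>V\<close> and a set \<open>E\<close> of
  two-element subsets of \<open>V\<close>.
\<close>

definition fourier_mat :: "nat \<Rightarrow> complex mat" where
  "fourier_mat N = mat N N (\<lambda>(m, x).
     complex_of_real (1 / sqrt (real N)) *
       exp (- (2 * complex_of_real pi * \<i> * of_nat m * of_nat x / of_nat N)))"

definition entrywise_l1_norm :: "complex mat \<Rightarrow> real" where
  "entrywise_l1_norm M = (\<Sum>i<dim_row M. \<Sum>j<dim_col M. cmod (M $$ (i, j)))"

definition frobenius_norm :: "complex mat \<Rightarrow> real" where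
  "frobenius_norm M = sqrt (\<Sum>i<dim_row M. \<Sum>j<dim_col M. (cmod (M $$ (i, j)))\<^sup>2)"

text \<open>Meaningful for nonzero square matrices; division by zero makes it 0 at the zero matrix.\<close>

definition fourier_ratio :: "complex mat \<Rightarrow> real" where
  "fourier_ratio M =
     (let F = fourier_mat (dim_row M) in
      entrywise_l1_norm (F * M * F) / frobenius_norm (F * M * F))"

text \<open>Extensionality only pins down the values outside \<open>V\<close>, so that labelings are the
  bijections with domain exactly \<open>V\<close>.\<close>

definition labelings :: "'v set \<Rightarrow> ('v \<Rightarrow> nat) set" where
  "labelings V = {\<sigma> \<in> extensional V. bij_betw \<sigma> V {..<card V}}"

definition adjacency_mat :: "'v set \<Rightarrow> 'v set set \<Rightarrow> ('v \<Rightarrow> nat) \<Rightarrow> complex mat" where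
  "adjacency_mat V E \<sigma> = mat (card V) (card V) (\<lambda>(x, y).
     if {inv_into V \<sigma> x, inv_into V \<sigma> y} \<in> E then 1 else 0)"

text \<open>Meaningful for \<open>E \<noteq> {}\<close>, when no adjacency matrix vanishes.\<close>

definition edge_complexity :: "'v set \<Rightarrow> 'v set set \<Rightarrow> real" where
  "edge_complexity V E = Min ((\<lambda>\<sigma>. fourier_ratio (adjacency_mat V E \<sigma>)) ` labelings V)"

text \<open>The minimum is over a finite nonempty set.\<close>

lemma finite_labelings: "finite V \<Longrightarrow> finite (labelings V)"
  by (rule finite_subset[OF _ finite_PiE[of V "\<lambda>_. {..<card V}"]])
     (auto simp: labelings_def PiE_def bij_betw_def)

lemma labelings_nonempty:
  assumes "finite V"
  shows "labelings V \<noteq> {}"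
proof -
  obtain \<sigma> where "bij_betw \<sigma> V {..<card V}"
    using ex_bij_betw_finite_nat[OF assms] by (auto simp: lessThan_atLeast0)
  then have "restrict \<sigma> V \<in> labelings V"
    by (simp add: labelings_def bij_betw_restrict_eq)
  then show ?thesis by blast
qed

definition possible_edges :: "nat \<Rightarrow> nat set set" where
  "possible_edges N = {e. e \<subseteq> {1..N} \<and> card e = 2}"

text \<open>The law of the edge set of \<open>G(N,p)\<close>: one independent Bernoulli(\<open>p\<close>) variable for each
  possible edge.\<close>

definition erdos_renyi :: "nat \<Rightarrow> real \<Rightarrow> nat set set pmf" where
  "erdos_renyi N p =
     map_pmf (\<lambda>f. {e \<in> possible_edges N. f e})
       (Pi_pmf (possible_edges N) False (\<lambda>_. bernoulli_pmf p))"

end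

theory Submission
  imports Defs "HOL-Real_Asymp.Real_Asymp"
begin

text \<open>
  The proof counts graphs. Since \<open>\<parallel>FAF\<parallel>\<^sub>2 = \<parallel>A\<parallel>\<^sub>2 \<le> N\<close>, a Fourier ratio below \<open>cN\<close> forces
  \<open>\<parallel>FAF\<parallel>\<^sub>1 \<le> cN\<^sup>2\<close>. Fix a labeling and truncate the real and imaginary parts of the entries of such
  an \<open>FAF\<close> towards zero to integers. The results are integer vectors with \<open>2N\<^sup>2\<close> coordinates and
  \<open>\<ell>\<^sup>1\<close>-norm at most \<open>2cN\<^sup>2\<close>, so there are only \<open>exp (\<epsilon>N\<^sup>2)\<close> of them, where \<open>\<epsilon>\<close> is small with \<open>c\<close>. By
  Parseval, two graphs with the same truncation differ in at most \<open>8cN\<^sup>2\<close> edges, which again leaves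
  \<open>exp (\<epsilon>N\<^sup>2)\<close> graphs for each truncation. As every single graph has probability at most
  \<open>(max p (1 - p)) ^ (N choose 2)\<close>, a union bound over the at most \<open>N ^ N\<close> labelings suffices.
\<close>

section \<open>Unitarity of the Fourier matrix and Parseval's identity\<close>

lemma fourier_mat_carrier [simp]: "fourier_mat N \<in> carrier_mat N N"
  by (simp add: fourier_mat_def)

lemma fourier_mat_index:
  assumes "m < N" "x < N"
  shows "fourier_mat N $$ (m, x) = cis (- (2 * pi * real m * real x / real N)) / sqrt (real N)"
  using assms by (simp add: fourier_mat_def cis_conv_exp mult_ac)

lemma fourier_mat_sym:
  assumes "m < N" "x < N"
  shows "fourier_mat N $$ (m, x) = fourier_mat N $$ (x, m)"
  using assms by (simp add: fourier_mat_index mult_ac)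

text \<open>Up to the factor 1/N this is a geometric sum in \<open>w\<close>, an N-th root of unity.
  It vanishes unless \<open>w = 1\<close>, which means that N divides y - x and hence, as |y - x| <
  N, that x = y.\<close>

lemma fourier_mat_orthogonal:
  assumes x: "x < N" and y: "y < N"
  shows "(\<Sum>m<N. fourier_mat N $$ (m, x) * cnj (fourier_mat N $$ (m, y))) = of_bool (x = y)"
proof -
  define t where "t = 2 * pi * (real y - real x) / real N"
  define w where "w = cis t"
  have N: "real N > 0" using x by simp
  have "fourier_mat N $$ (m, x) * cnj (fourier_mat N $$ (m, y)) = w ^ m / of_nat N" if "m < N" for m
  proof -
    have "w ^ m = cis (- (2 * pi * real m * real x / real N)) * cis (2 * pi * real m * real y / real N)"
      unfolding w_def t_def Complex.DeMoivre cis_mult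
      by (rule arg_cong[of _ _ cis]) (simp add: algebra_simps add_divide_distrib diff_divide_distrib)
    moreover have "complex_of_real (sqrt (real N)) * complex_of_real (sqrt (real N)) = of_nat N"
      using N by (simp flip: of_real_mult)
    ultimately show ?thesis
      using that x y by (simp add: fourier_mat_index cis_cnj)
  qed
  then have eq: "(\<Sum>m<N. fourier_mat N $$ (m, x) * cnj (fourier_mat N $$ (m, y))) = (\<Sum>m<N. w ^ m) / of_nat N"
    by (simp add: sum_divide_distrib)
  show ?thesis
  proof (cases "x = y")
    case True
    then show ?thesis using eq N by (simp add: w_def t_def)
  next
    case False
    have "w ^ N = cis (2 * pi * of_int (int y - int x))"
      unfolding w_def t_def Complex.DeMoivre using N by simp
    also have "\<dots> = 1"
      by (rule cis_multiple_2pi) simp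
    finally have wN: "w ^ N = 1" .
    have "w \<noteq> 1"
    proof
      assume "w = 1"
      then have "cos t = 1" by (simp add: w_def complex_eq_iff)
      then obtain k :: int where "t = of_int k * 2 * pi"
        by (auto simp: cos_one_2pi_int)
      then have "2 * pi * ((real y - real x) / real N) = 2 * pi * of_int k"
        by (simp add: t_def mult_ac)
      then have "(real y - real x) / real N = of_int k"
        unfolding mult_cancel_left by simp
      then have "real_of_int (int y - int x) = of_int (k * int N)"
        using N by (simp add: divide_eq_eq)
      then have k: "int y - int x = k * int N"
        by (simp only: of_int_eq_iff)
      then have "\<bar>k * int N\<bar> < int N" using x y by linarith
      then have "\<bar>k\<bar> * int N < 1 * int N" by (simp add: abs_mult)
      then have "k = 0" using N by (simp add: mult_less_cancel_right)
      then show False using k False by simp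
    qed
    then show ?thesis using eq wN False by (simp add: sum_gp_strict)
  qed
qed

lemma fourier_parseval:
  fixes f :: "nat \<Rightarrow> complex"
  shows "(\<Sum>m<N. (cmod (\<Sum>x<N. fourier_mat N $$ (m, x) * f x))\<^sup>2) = (\<Sum>x<N. (cmod (f x))\<^sup>2)"
proof -
  let ?F = "\<lambda>m x. fourier_mat N $$ (m, x)"
  have "complex_of_real (\<Sum>m<N. (cmod (\<Sum>x<N. ?F m x * f x))\<^sup>2) =
      (\<Sum>m<N. \<Sum>x<N. \<Sum>y<N. f x * cnj (f y) * (?F m x * cnj (?F m y)))"
    by (simp only: of_real_sum complex_norm_square cnj_sum sum_product complex_cnj_mult mult_ac)
  also have "\<dots> = (\<Sum>x<N. \<Sum>y<N. f x * cnj (f y) * (\<Sum>m<N. ?F m x * cnj (?F m y)))"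
    by (subst sum.swap, rule sum.cong[OF refl], subst sum.swap) (simp add: sum_distrib_left)
  also have "\<dots> = (\<Sum>x<N. \<Sum>y<N. f x * cnj (f y) * of_bool (x = y))"
    by (intro sum.cong refl) (simp add: fourier_mat_orthogonal)
  also have "\<dots> = (\<Sum>x<N. f x * cnj (f x))"
    by (simp add: of_bool_def if_distrib cong: if_cong)
  also have "\<dots> = complex_of_real (\<Sum>x<N. (cmod (f x))\<^sup>2)"
    by (simp only: of_real_sum complex_norm_square)
  finally show ?thesis by (simp only: of_real_eq_iff)
qed

text \<open>Parseval for vectors is applied twice: first to the rows of \<open>F * M\<close>, then
  to the columns of \<open>M\<close>.\<close>

lemma fourier_parseval_mat:
  assumes M: "M \<in> carrier_mat N N"
  shows "(\<Sum>i<N. \<Sum>j<N. (cmod ((fourier_mat N * M * fourier_mat N) $$ (i, j)))\<^sup>2) =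
         (\<Sum>i<N. \<Sum>j<N. (cmod (M $$ (i, j)))\<^sup>2)"
proof -
  let ?F = "fourier_mat N"
  have dim: "dim_row ?F = N" "dim_col ?F = N" "dim_row M = N" "dim_col M = N"
    using M by (auto simp: fourier_mat_def)
  \<comment> \<open>The symmetry of F turns multiplication from the right into the Fourier transform
    of row i.\<close>
  have "(?F * M * ?F) $$ (i, j) = (\<Sum>y<N. ?F $$ (j, y) * (?F * M) $$ (i, y))"
    if "i < N" "j < N" for i j
    using that dim by (simp add: scalar_prod_def atLeast0LessThan fourier_mat_sym[of j] mult_ac)
  then have "(\<Sum>i<N. \<Sum>j<N. (cmod ((?F * M * ?F) $$ (i, j)))\<^sup>2) =
      (\<Sum>i<N. \<Sum>j<N. (cmod (\<Sum>y<N. ?F $$ (j, y) * (?F * M) $$ (i, y)))\<^sup>2)"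
    by simp
  also have "\<dots> = (\<Sum>i<N. \<Sum>y<N. (cmod ((?F * M) $$ (i, y)))\<^sup>2)"
    by (simp add: fourier_parseval)
  also have "\<dots> = (\<Sum>y<N. \<Sum>i<N. (cmod (\<Sum>x<N. ?F $$ (i, x) * M $$ (x, y)))\<^sup>2)"
    using dim by (subst sum.swap) (simp add: scalar_prod_def atLeast0LessThan)
  also have "\<dots> = (\<Sum>y<N. \<Sum>x<N. (cmod (M $$ (x, y)))\<^sup>2)"
    by (simp add: fourier_parseval)
  also have "\<dots> = (\<Sum>i<N. \<Sum>j<N. (cmod (M $$ (i, j)))\<^sup>2)"
    by (rule sum.swap)
  finally show ?thesis .
qed

section \<open>Exponential counting bounds\<close>

text \<open>Chernoff's method for counting: each member of \<open>S\<close> contributes at least 1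
  to the sum of \<open>exp (l * (L - weight))\<close>, and extending this sum to all functions makes
  it a product over the coordinates. The parameter \<open>l\<close> stays free until the constants
  are fixed in the theorem.\<close>

lemma card_small_weight_le:
  fixes w :: "'b \<Rightarrow> real" and l :: real
  assumes I: "finite I" and T: "finite T" and S: "S \<subseteq> I \<rightarrow>\<^sub>E T"
    and L: "\<And>f. f \<in> S \<Longrightarrow> (\<Sum>i\<in>I. w (f i)) \<le> L" and l: "0 \<le> l"
  shows "real (card S) \<le> exp (l * L) * (\<Sum>t\<in>T. exp (- l * w t)) ^ card I"
proof -
  have "real (card S) = (\<Sum>f\<in>S. 1)" by simp
  also have "\<dots> \<le> (\<Sum>f\<in>S. exp (l * L) * (\<Prod>i\<in>I. exp (- l * w (f i))))"
  proof (rule sum_mono)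
    fix f assume "f \<in> S"
    then have "l * (\<Sum>i\<in>I. w (f i)) \<le> l * L"
      using L l by (intro mult_left_mono)
    then show "1 \<le> exp (l * L) * (\<Prod>i\<in>I. exp (- l * w (f i)))"
      using I by (simp add: sum_distrib_left sum_negf flip: exp_sum exp_add)
  qed
  also have "\<dots> \<le> (\<Sum>f\<in>I \<rightarrow>\<^sub>E T. exp (l * L) * (\<Prod>i\<in>I. exp (- l * w (f i))))"
    using S I T by (intro sum_mono2) (auto intro!: finite_PiE mult_nonneg_nonneg prod_nonneg)
  also have "\<dots> = exp (l * L) * (\<Sum>t\<in>T. exp (- l * w t)) ^ card I"
    using I T by (simp add: sum_distrib_left[symmetric] prod_sum_PiE[of I "\<lambda>_. T" "\<lambda>_ t. exp (- (l * w t))", symmetric])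
  finally show ?thesis .
qed

text \<open>The weighted count with values in \<open>bool\<close> and weight \<open>of_bool\<close>,
  so that a set weighs its cardinality. The inequality 1 + x \<le> exp x then puts the product into
  exponential form.\<close>

lemma card_small_subsets_le:
  fixes l L :: real
  assumes I: "finite I" and S: "S \<subseteq> Pow I" and L: "\<And>A. A \<in> S \<Longrightarrow> real (card A) \<le> L" and l: "0 \<le> l"
  shows "real (card S) \<le> exp (l * L + exp (- l) * card I)"
proof -
  let ?g = "\<lambda>A. restrict (\<lambda>i. i \<in> A) I"
  have inj: "inj_on ?g S"
  proof (rule inj_onI)
    fix A B assume AB: "A \<in> S" "B \<in> S" and eq: "?g A = ?g B"
    have "i \<in> A \<longleftrightarrow> i \<in> B" if "i \<in> I" for i
      using fun_cong[OF eq, of i] that by simp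
    then show "A = B" using AB S by blast
  qed
  have "real (card (?g ` S)) \<le> exp (l * L) * (\<Sum>t\<in>UNIV. exp (- l * of_bool t)) ^ card I"
  proof (rule card_small_weight_le[OF I _ _ _ l])
    fix f assume "f \<in> ?g ` S"
    then obtain A where A: "A \<in> S" "f = ?g A" by auto
    then have "I \<inter> A = A" using S by auto
    then show "(\<Sum>i\<in>I. of_bool (f i)) \<le> L"
      using A L[of A] I by (simp add: of_bool_def sum.If_cases cong: sum.cong) 
  qed auto
  also have "(\<Sum>t\<in>UNIV. exp (- l * of_bool t)) = 1 + exp (- l)"
    by (simp add: UNIV_bool)
  also have "exp (l * L) * (1 + exp (- l)) ^ card I \<le> exp (l * L) * exp (exp (- l)) ^ card I"
    by (intro mult_left_mono power_mono exp_ge_add_one_self) (auto intro: add_nonneg_nonneg)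
  also have "\<dots> = exp (l * L + exp (- l) * card I)"
    by (simp add: exp_add exp_of_nat_mult[symmetric] mult_ac)
  finally show ?thesis by (simp only: card_image[OF inj])
qed

text \<open>Two geometric series with ratio q = exp (-l) \<le> 1/2. The bound does not depend on
  \<open>R\<close>, so the box of admissible integers may be arbitrarily large.\<close>

lemma sum_exp_abs_int_le:
  fixes l :: real
  assumes "ln 2 \<le> l"
  shows "(\<Sum>k\<in>{-int R..int R}. exp (- l * real_of_int \<bar>k\<bar>)) \<le> 1 + 4 * exp (- l)"
proof -
  define q where "q = exp (- l)"
  have q: "0 < q" "q \<le> 1/2"
  proof -
    have "exp (- l) \<le> exp (- ln 2)" using assms by simp
    then show "q \<le> 1/2" by (simp add: q_def exp_minus)
  qed (simp add: q_def)
  have *: "(\<Sum>k\<in>{-int R..int R}. exp (- l * real_of_int \<bar>k\<bar>)) = 1 + 2 * (\<Sum>k<R. q ^ Suc k)"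
  proof (induction R)
    case (Suc R)
    have "{-int (Suc R)..int (Suc R)} = insert (int (Suc R)) (insert (- int (Suc R)) {-int R..int R})"
      by auto
    moreover have "exp (- l * real (Suc R)) = q ^ Suc R"
      by (simp only: q_def exp_of_nat_mult[symmetric] mult.commute)
    ultimately show ?case using Suc
      by (simp add: algebra_simps)
  qed auto
  have "(\<Sum>k<R. q ^ k) = (1 - q ^ R) / (1 - q)"
    using q by (subst sum_gp_strict) auto
  also have "\<dots> \<le> 2"
  proof -
    have "0 \<le> q ^ R" using q by simp
    then have "1 - q ^ R \<le> 2 * (1 - q)"
      using q \<open>0 \<le> q ^ R\<close> unfolding right_diff_distrib by linarith
    then show ?thesis using q by (simp add: divide_le_eq)
  qed
  finally have "q * (\<Sum>k<R. q ^ k) \<le> q * 2"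
    using q by (intro mult_left_mono) auto
  then show ?thesis
    unfolding * by (simp add: sum_distrib_left[symmetric]) (simp add: q_def)
qed

section \<open>Truncation of matrices to integers\<close>

text \<open>Rounding goes towards zero so that absolute values never grow; the floor would send
  every small negative number to -1 and spoil the \<ell>1 bound.\<close>

definition trunc :: "real \<Rightarrow> int" where
  "trunc x = (if 0 \<le> x then \<lfloor>x\<rfloor> else \<lceil>x\<rceil>)"

lemma abs_trunc_le: "real_of_int \<bar>trunc x\<bar> \<le> \<bar>x\<bar>"
proof (cases "0 \<le> x")
  case False
  then have "\<lceil>x\<rceil> \<le> 0" by simp
  then show ?thesis using False le_of_int_ceiling[of x] by (simp add: trunc_def)
qed (simp add: trunc_def)

text \<open>Equal truncations leave a gap of at most 2 (both numbers may lie between -1 and 1), so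
  the square of the gap is at most twice the gap. This is how an \<ell>1 bound comes to control a
  squared \<ell>2 distance.\<close>

lemma trunc_eq_imp_sq_diff_le:
  assumes "trunc x = trunc y"
  shows "(x - y)\<^sup>2 \<le> 2 * (\<bar>x\<bar> + \<bar>y\<bar>)"
proof -
  have "\<bar>x - y\<bar> \<le> 2"
    using assms unfolding trunc_def by (auto split: if_splits) linarith+
  then have "\<bar>x - y\<bar> * \<bar>x - y\<bar> \<le> 2 * \<bar>x - y\<bar>"
    by (intro mult_right_mono) auto
  also have "\<dots> \<le> 2 * (\<bar>x\<bar> + \<bar>y\<bar>)"
    using abs_triangle_ineq4[of x y] by simp
  finally show ?thesis by (simp add: power2_eq_square)
qed

lemma trunc_eq_imp_cmod_diff_le:
  assumes "trunc (Re z) = trunc (Re w)" "trunc (Im z) = trunc (Im w)"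
  shows "(cmod (z - w))\<^sup>2 \<le> 4 * (cmod z + cmod w)"
proof -
  have "(cmod (z - w))\<^sup>2 = (Re z - Re w)\<^sup>2 + (Im z - Im w)\<^sup>2"
    by (simp add: cmod_power2)
  then show ?thesis
    using trunc_eq_imp_sq_diff_le[OF assms(1)] trunc_eq_imp_sq_diff_le[OF assms(2)]
      abs_Re_le_cmod[of z] abs_Re_le_cmod[of w] abs_Im_le_cmod[of z] abs_Im_le_cmod[of w]
    unfolding distrib_left by linarith
qed

text \<open>The boolean selects the real or the imaginary part, so a matrix becomes one extensional
  integer vector with 2N^2 coordinates, as the counting bound requires.\<close>

definition trunc_mat :: "nat \<Rightarrow> complex mat \<Rightarrow> nat \<times> nat \<times> bool \<Rightarrow> int" where
  "trunc_mat N M = restrict (\<lambda>(i, j, b). trunc (if b then Re (M $$ (i, j)) else Im (M $$ (i, j))))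
     ({..<N} \<times> {..<N} \<times> UNIV)"

lemma sum_abs_trunc_mat_le:
  assumes "M \<in> carrier_mat N N"
  shows "(\<Sum>k\<in>{..<N} \<times> {..<N} \<times> UNIV. real_of_int \<bar>trunc_mat N M k\<bar>) \<le> 2 * entrywise_l1_norm M"
proof -
  have "(\<Sum>k\<in>{..<N} \<times> {..<N} \<times> UNIV. real_of_int \<bar>trunc_mat N M k\<bar>) =
      (\<Sum>i<N. \<Sum>j<N. \<Sum>b\<in>UNIV. real_of_int \<bar>trunc_mat N M (i, j, b)\<bar>)"
    by (simp add: sum.cartesian_product case_prod_unfold)
  also have "\<dots> \<le> (\<Sum>i<N. \<Sum>j<N. 2 * cmod (M $$ (i, j)))"
  proof (intro sum_mono)
    fix i j assume "i \<in> {..<N}" "j \<in> {..<N}"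
    then have "(\<Sum>b\<in>UNIV. real_of_int \<bar>trunc_mat N M (i, j, b)\<bar>) =
        real_of_int \<bar>trunc (Re (M $$ (i, j)))\<bar> + real_of_int \<bar>trunc (Im (M $$ (i, j)))\<bar>"
      by (simp add: trunc_mat_def UNIV_bool)
    also have "\<dots> \<le> 2 * cmod (M $$ (i, j))"
      using abs_trunc_le[of "Re (M $$ (i, j))"] abs_trunc_le[of "Im (M $$ (i, j))"]
        abs_Re_le_cmod[of "M $$ (i, j)"] abs_Im_le_cmod[of "M $$ (i, j)"] by linarith
    finally show "(\<Sum>b\<in>UNIV. real_of_int \<bar>trunc_mat N M (i, j, b)\<bar>) \<le> 2 * cmod (M $$ (i, j))" .
  qed
  also have "\<dots> = 2 * entrywise_l1_norm M"
    using assms by (simp add: entrywise_l1_norm_def sum_distrib_left)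
  finally show ?thesis .
qed

lemma trunc_mat_eq_imp_sum_sq_diff_le:
  assumes M: "M \<in> carrier_mat N N" and M': "M' \<in> carrier_mat N N"
    and eq: "trunc_mat N M = trunc_mat N M'"
  shows "(\<Sum>i<N. \<Sum>j<N. (cmod (M $$ (i, j) - M' $$ (i, j)))\<^sup>2) \<le>
    4 * (entrywise_l1_norm M + entrywise_l1_norm M')"
proof -
  have "(\<Sum>i<N. \<Sum>j<N. (cmod (M $$ (i, j) - M' $$ (i, j)))\<^sup>2) \<le>
      (\<Sum>i<N. \<Sum>j<N. 4 * (cmod (M $$ (i, j)) + cmod (M' $$ (i, j))))"
  proof (intro sum_mono trunc_eq_imp_cmod_diff_le)
    fix i j assume "i \<in> {..<N}" "j \<in> {..<N}"
    then show "trunc (Re (M $$ (i, j))) = trunc (Re (M' $$ (i, j)))"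
      "trunc (Im (M $$ (i, j))) = trunc (Im (M' $$ (i, j)))"
      using fun_cong[OF eq, of "(i, j, True)"] fun_cong[OF eq, of "(i, j, False)"]
      by (simp_all add: trunc_mat_def)
  qed
  also have "\<dots> = 4 * (entrywise_l1_norm M + entrywise_l1_norm M')"
    using M M' by (simp add: entrywise_l1_norm_def sum_distrib_left sum.distrib)
  finally show ?thesis .
qed

text \<open>The weighted count for integer vectors of weight at most 2L: each of the 2N^2
  coordinates contributes a factor of at most \<open>exp (4 * exp (- l))\<close>. Only the image is
  counted; \<open>S\<close> itself may be infinite.\<close>

lemma card_trunc_mat_image_le:
  fixes l L :: real
  assumes S: "S \<subseteq> carrier_mat N N" and L: "\<And>M. M \<in> S \<Longrightarrow> entrywise_l1_norm M \<le> L"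
    and l: "ln 2 \<le> l"
  shows "real (card (trunc_mat N ` S)) \<le> exp (2 * l * L + 8 * exp (- l) * real (N ^ 2))"
proof -
  let ?I = "{..<N} \<times> {..<N} \<times> (UNIV :: bool set)"
  \<comment> \<open>No single coordinate can exceed the total weight 2L, so this box holds all
    truncations; its size does not enter the bound.\<close>
  define R where "R = nat \<lfloor>2 * L\<rfloor>"
  have l0: "0 \<le> l" using l ln_gt_zero[of "2::real"] by linarith
  have small: "(\<Sum>k\<in>?I. real_of_int \<bar>f k\<bar>) \<le> 2 * L" if f: "f \<in> trunc_mat N ` S" for f
  proof -
    obtain M where M: "M \<in> S" "f = trunc_mat N M" using f by auto
    then have "M \<in> carrier_mat N N" using S by auto
    from sum_abs_trunc_mat_le[OF this] L[OF M(1)] show ?thesis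
      unfolding M(2) by linarith
  qed
  have sub: "trunc_mat N ` S \<subseteq> ?I \<rightarrow>\<^sub>E {- int R..int R}"
  proof
    fix f assume f: "f \<in> trunc_mat N ` S"
    have "f k \<in> {- int R..int R}" if k: "k \<in> ?I" for k
    proof -
      have "real_of_int \<bar>f k\<bar> \<le> (\<Sum>k\<in>?I. real_of_int \<bar>f k\<bar>)"
        using k by (intro member_le_sum) auto
      also note small[OF f]
      finally have "\<bar>f k\<bar> \<le> \<lfloor>2 * L\<rfloor>" by (simp only: le_floor_iff)
      then have "\<bar>f k\<bar> \<le> int R" unfolding R_def by linarith
      then show ?thesis by auto
    qed
    moreover have "f \<in> extensional ?I" using f by (auto simp: trunc_mat_def)
    ultimately show "f \<in> ?I \<rightarrow>\<^sub>E {- int R..int R}" by (simp add: PiE_iff)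
  qed
  have cardI: "card ?I = 2 * N ^ 2"
    by (simp add: card_cartesian_product power2_eq_square)
  have "real (card (trunc_mat N ` S)) \<le>
      exp (l * (2 * L)) * (\<Sum>t\<in>{- int R..int R}. exp (- l * real_of_int \<bar>t\<bar>)) ^ card ?I"
    by (rule card_small_weight_le[OF _ _ sub small l0]) auto
  also have "\<dots> \<le> exp (l * (2 * L)) * exp (4 * exp (- l)) ^ card ?I"
  proof (intro mult_left_mono power_mono)
    show "(\<Sum>t\<in>{- int R..int R}. exp (- l * real_of_int \<bar>t\<bar>)) \<le> exp (4 * exp (- l))"
      using sum_exp_abs_int_le[OF l, of R] exp_ge_add_one_self[of "4 * exp (- l)"] by linarith
  qed (auto intro: sum_nonneg)
  also have "\<dots> = exp (2 * l * L + 8 * exp (- l) * real (N ^ 2))"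
    unfolding cardI by (simp add: exp_of_nat_mult[symmetric] mult_ac flip: exp_add)
  finally show ?thesis .
qed

section \<open>Counting graphs with small Fourier \<ell>1-norm under a fixed labeling\<close>

lemma card_le_card_image_fibres:
  fixes K :: real
  assumes "finite S" and K: "\<And>x. x \<in> S \<Longrightarrow> real (card {y \<in> S. f y = f x}) \<le> K"
  shows "real (card S) \<le> real (card (f ` S)) * K"
proof -
  have "real (card S) = (\<Sum>z\<in>f ` S. real (card {y \<in> S. f y = z}))"
    using sum.image_gen[OF assms(1), of "\<lambda>_. 1::real" f] by simp
  also have "\<dots> \<le> (\<Sum>z\<in>f ` S. K)"
    using K by (intro sum_mono) auto
  finally show ?thesis by simp
qed

lemma adjacency_mat_carrier [simp]: "adjacency_mat V E \<sigma> \<in> carrier_mat (card V) (card V)"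
  by (simp add: adjacency_mat_def)

text \<open>Every edge in which the graphs differ shows up as an entry where the matrices differ by
  1 in modulus. It even shows up twice, at (x, y) and (y, x), but this factor 2 is given
  away.\<close>

lemma card_symdiff_le_adjacency_mat:
  assumes \<sigma>: "bij_betw \<sigma> V {..<card V}"
    and E: "E \<subseteq> {e. e \<subseteq> V \<and> card e = 2}" and E': "E' \<subseteq> {e. e \<subseteq> V \<and> card e = 2}"
  shows "real (card (sym_diff E E')) \<le> (\<Sum>x<card V. \<Sum>y<card V.
    (cmod (adjacency_mat V E \<sigma> $$ (x, y) - adjacency_mat V E' \<sigma> $$ (x, y)))\<^sup>2)"
proof -
  let ?n = "card V"
  let ?g = "\<lambda>(x, y). {inv_into V \<sigma> x, inv_into V \<sigma> y}"
  let ?D = "{k \<in> {..<?n} \<times> {..<?n}. ?g k \<in> sym_diff E E'}"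
  have "sym_diff E E' \<subseteq> ?g ` ?D"
  proof
    fix e assume e: "e \<in> sym_diff E E'"
    then have "e \<subseteq> V" "card e = 2" using E E' by auto
    then obtain a b where ab: "e = {a, b}" "a \<in> V" "b \<in> V"
      by (auto simp: card_2_iff)
    have "?g (\<sigma> a, \<sigma> b) = e"
      using ab \<sigma> by (simp add: bij_betw_inv_into_left)
    moreover have "(\<sigma> a, \<sigma> b) \<in> {..<?n} \<times> {..<?n}"
      using ab \<sigma> by (auto dest: bij_betwE)
    ultimately show "e \<in> ?g ` ?D" using e by (intro image_eqI[of _ _ "(\<sigma> a, \<sigma> b)"]) auto
  qed
  then have "card (sym_diff E E') \<le> card ?D"
    by (intro surj_card_le) auto
  then have "real (card (sym_diff E E')) \<le> real (card ?D)" by simp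
  also have "\<dots> = (\<Sum>k\<in>{..<?n} \<times> {..<?n}. of_bool (?g k \<in> sym_diff E E'))"
    by (simp add: of_bool_def sum.If_cases Int_def)
  also have "\<dots> = (\<Sum>x<?n. \<Sum>y<?n. of_bool (?g (x, y) \<in> sym_diff E E'))"
    by (simp only: sum.cartesian_product) (simp add: case_prod_unfold)
  also have "\<dots> = (\<Sum>x<?n. \<Sum>y<?n.
      (cmod (adjacency_mat V E \<sigma> $$ (x, y) - adjacency_mat V E' \<sigma> $$ (x, y)))\<^sup>2)"
    by (intro sum.cong refl) (auto simp: adjacency_mat_def)
  finally show ?thesis .
qed

definition fourier_mat_transform :: "nat \<Rightarrow> complex mat \<Rightarrow> complex mat" where
  "fourier_mat_transform N M = fourier_mat N * M * fourier_mat N"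

lemma fourier_mat_transform_carrier [simp]: "fourier_mat_transform N M \<in> carrier_mat N N"
  by (rule carrier_matI) (simp_all add: fourier_mat_transform_def fourier_mat_def)

lemma fourier_mat_transform_diff:
  assumes "M \<in> carrier_mat N N" "M' \<in> carrier_mat N N"
  shows "fourier_mat_transform N (M - M') = fourier_mat_transform N M - fourier_mat_transform N M'"
proof -
  have F: "fourier_mat N \<in> carrier_mat N N" by simp
  show ?thesis unfolding fourier_mat_transform_def
    by (subst mult_minus_distrib_mat[OF F assms], subst minus_mult_distrib_mat[OF _ _ F])
       (use F assms in auto)
qed

text \<open>The number of truncations times the size of the largest fibre. Per N^2, the truncations
  contribute 2lc + 8exp(-l) to the exponent and a fibre contributes 8lc + exp(-l).\<close>

lemma card_small_fourier_l1_le: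
  fixes c l :: real
  assumes V: "finite V" and \<sigma>: "bij_betw \<sigma> V {..<card V}" and l: "ln 2 \<le> l" and N: "N = card V"
  shows "real (card {E. E \<subseteq> {e. e \<subseteq> V \<and> card e = 2} \<and>
      entrywise_l1_norm (fourier_mat_transform N (adjacency_mat V E \<sigma>)) \<le> c * real (N ^ 2)})
    \<le> exp ((10 * l * c + 9 * exp (- l)) * real (N ^ 2))"
proof -
  let ?P = "{e. e \<subseteq> V \<and> card e = 2}"
  let ?h = "\<lambda>E. fourier_mat_transform N (adjacency_mat V E \<sigma>)"
  let ?L = "c * real (N ^ 2)"
  define S where "S = {E. E \<subseteq> ?P \<and> entrywise_l1_norm (?h E) \<le> ?L}"
  have l0: "0 \<le> l" using l ln_gt_zero[of "2::real"] by linarith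
  have finP: "finite ?P" using V by (auto intro: finite_subset[of _ "Pow V"])
  have "finite S" unfolding S_def using finP by (auto intro: finite_subset[of _ "Pow ?P"])
  have cardP: "card ?P \<le> N ^ 2"
  proof -
    have "card ?P = N choose 2" using n_subsets[OF V] N by simp
    also have "\<dots> \<le> N ^ 2" by (simp add: choose_two power2_eq_square order.trans[OF div_le_dividend])
    finally show ?thesis .
  qed
  have "real (card S) \<le> real (card ((\<lambda>E. trunc_mat N (?h E)) ` S)) *
      exp (l * (8 * ?L) + exp (- l) * real (N ^ 2))"
  proof (rule card_le_card_image_fibres[OF \<open>finite S\<close>])
    fix E assume E: "E \<in> S"
    define B where "B = {E' \<in> S. trunc_mat N (?h E') = trunc_mat N (?h E)}"
    \<comment> \<open>Relative to the fixed \<open>E\<close>, a graph in the fibre is determined by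
      the set of edges in which it differs from \<open>E\<close>, so it suffices to count small edge
      sets.\<close>
    have inj: "inj_on (sym_diff E) B"
      by (rule inj_onI) blast
    have "real (card (sym_diff E ` B)) \<le> exp (l * (8 * ?L) + exp (- l) * card ?P)"
    proof (rule card_small_subsets_le[OF finP _ _ l0])
      show "sym_diff E ` B \<subseteq> Pow ?P"
        using E unfolding B_def S_def by blast
      fix A assume "A \<in> sym_diff E ` B"
      then obtain E' where E': "E' \<in> B" "A = sym_diff E E'" by auto
      have sub: "E \<subseteq> ?P" "E' \<subseteq> ?P" using E E' by (auto simp: B_def S_def)
      let ?A = "adjacency_mat V E \<sigma>" and ?A' = "adjacency_mat V E' \<sigma>"
      have car: "?A \<in> carrier_mat N N" "?A' \<in> carrier_mat N N" by (simp_all add: N)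
      then have dim: "dim_row ?A = N" "dim_col ?A = N" "dim_row ?A' = N" "dim_col ?A' = N" by auto
      have dim': "dim_row (fourier_mat_transform N M) = N" "dim_col (fourier_mat_transform N M) = N" for M
        using fourier_mat_transform_carrier[of N M] by (blast dest: carrier_matD)+
      \<comment> \<open>Parseval carries the distance of the adjacency matrices over to their
        transforms, where the equal truncations bound it by 4(L + L).\<close>
      have "real (card A) \<le> (\<Sum>x<N. \<Sum>y<N. (cmod (?A $$ (x, y) - ?A' $$ (x, y)))\<^sup>2)"
        unfolding E'(2) N by (rule card_symdiff_le_adjacency_mat[OF \<sigma> sub])
      also have "\<dots> = (\<Sum>x<N. \<Sum>y<N. (cmod ((?A - ?A') $$ (x, y)))\<^sup>2)"
        by (intro sum.cong refl) (simp add: dim)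
      also have "\<dots> = (\<Sum>x<N. \<Sum>y<N. (cmod (fourier_mat_transform N (?A - ?A') $$ (x, y)))\<^sup>2)"
        unfolding fourier_mat_transform_def by (rule fourier_parseval_mat[symmetric]) (rule minus_carrier_mat[OF car(2)])
      also have "\<dots> = (\<Sum>x<N. \<Sum>y<N. (cmod (?h E $$ (x, y) - ?h E' $$ (x, y)))\<^sup>2)"
        unfolding fourier_mat_transform_diff[OF car] by (intro sum.cong refl) (simp add: dim')
      also have "\<dots> \<le> 4 * (entrywise_l1_norm (?h E) + entrywise_l1_norm (?h E'))"
        using E' by (intro trunc_mat_eq_imp_sum_sq_diff_le) (auto simp: B_def)
      also have "\<dots> \<le> 4 * (?L + ?L)"
        using E E' unfolding B_def S_def by (intro mult_left_mono add_mono) auto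
      finally show "real (card A) \<le> 8 * ?L" by simp
    qed
    also have "\<dots> \<le> exp (l * (8 * ?L) + exp (- l) * real (N ^ 2))"
      using cardP by (simp only: exp_le_cancel_iff add_le_cancel_left) (intro mult_left_mono, simp_all flip: of_nat_power)
    finally show "real (card {E' \<in> S. trunc_mat N (?h E') = trunc_mat N (?h E)}) \<le>
        exp (l * (8 * ?L) + exp (- l) * real (N ^ 2))"
      unfolding card_image[OF inj] unfolding B_def .
  qed
  also have "\<dots> \<le> exp (2 * l * ?L + 8 * exp (- l) * real (N ^ 2)) *
      exp (l * (8 * ?L) + exp (- l) * real (N ^ 2))"
  proof (rule mult_right_mono)
    have "real (card (trunc_mat N ` ?h ` S)) \<le> exp (2 * l * ?L + 8 * exp (- l) * real (N ^ 2))"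
      by (rule card_trunc_mat_image_le[OF _ _ l]) (auto simp: S_def)
    then show "real (card ((\<lambda>E. trunc_mat N (?h E)) ` S)) \<le> exp (2 * l * ?L + 8 * exp (- l) * real (N ^ 2))"
      by (simp only: image_image)
  qed simp
  also have "\<dots> = exp ((10 * l * c + 9 * exp (- l)) * real (N ^ 2))"
    unfolding exp_add[symmetric] by (rule arg_cong[of _ _ exp]) (simp add: algebra_simps)
  finally show ?thesis unfolding S_def .
qed

section \<open>Probabilities in G(N,p) and the union bound\<close>

lemma finite_possible_edges [simp]: "finite (possible_edges N)"
  by (rule finite_subset[of _ "Pow {1..N}"]) (auto simp: possible_edges_def)

lemma card_possible_edges: "card (possible_edges N) = N choose 2"
  using n_subsets[of "{1..N}" 2] by (simp add: possible_edges_def)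

lemma set_pmf_erdos_renyi: "set_pmf (erdos_renyi N p) \<subseteq> Pow (possible_edges N)"
  by (auto simp: erdos_renyi_def)

text \<open>The mass of a graph is a product with one factor p or 1 - p for each of the N choose 2
  possible edges.\<close>

lemma pmf_erdos_renyi_le:
  assumes "0 < p" "p < 1"
  shows "pmf (erdos_renyi N p) E \<le> max p (1 - p) ^ (N choose 2)"
proof (cases "E \<in> set_pmf (erdos_renyi N p)")
  case False
  then show ?thesis using assms by (simp add: set_pmf_iff)
next
  case True
  let ?P = "possible_edges N"
  let ?Q = "Pi_pmf ?P False (\<lambda>_. bernoulli_pmf p)"
  let ?g = "\<lambda>f. {e \<in> ?P. f e}"
  have supp: "f e = False" if "f \<in> set_pmf ?Q" "e \<notin> ?P" for f e
    using set_Pi_pmf_subset[of ?P False "\<lambda>_. bernoulli_pmf p"] that by auto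
  obtain f where f: "f \<in> set_pmf ?Q" "E = ?g f"
    using True by (auto simp: erdos_renyi_def)
  \<comment> \<open>On the support, \<open>f\<close> has the default value \<open>False\<close> off
    the possible edges, so it can be recovered from its edge set.\<close>
  have "inj_on ?g (set_pmf ?Q)"
  proof (rule inj_onI, rule ext)
    fix f f' e assume "f \<in> set_pmf ?Q" "f' \<in> set_pmf ?Q" "?g f = ?g f'"
    then show "f e = f' e" using supp[of f e] supp[of f' e] by (cases "e \<in> ?P") blast+
  qed
  then have "pmf (erdos_renyi N p) E = pmf ?Q f"
    unfolding f(2) erdos_renyi_def using f(1) by (rule pmf_map_inj)
  also have "\<dots> = (\<Prod>e\<in>?P. pmf (bernoulli_pmf p) (f e))"
    using supp[OF f(1)] by (intro pmf_Pi') auto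
  also have "\<dots> \<le> (\<Prod>e\<in>?P. max p (1 - p))"
  proof (intro prod_mono conjI)
    fix e show "pmf (bernoulli_pmf p) (f e) \<le> max p (1 - p)"
      using assms by (cases "f e") auto
  qed simp
  finally show ?thesis by (simp add: card_possible_edges)
qed

lemma card_labelings_le:
  assumes "finite V"
  shows "card (labelings V) \<le> card V ^ card V"
proof -
  have "labelings V \<subseteq> V \<rightarrow>\<^sub>E {..<card V}"
    by (auto simp: labelings_def PiE_def bij_betw_def)
  then have "card (labelings V) \<le> card (V \<rightarrow>\<^sub>E {..<card V})"
    using assms by (intro card_mono finite_PiE) auto
  then show ?thesis using assms by (simp add: card_PiE)
qed

text \<open>The minimum is attained by some labeling, and there \<ell>1 = FR * \<ell>2 with \<ell>2
  at most N by Parseval. The edgeless graph is included because it belongs to the complement of the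
  event in the theorem.\<close>

lemma edge_complexity_small_imp:
  fixes c :: real
  assumes V: "finite V" and c: "0 < c" and small: "E = {} \<or> edge_complexity V E < c * real (card V)"
  shows "\<exists>\<sigma>\<in>labelings V.
    entrywise_l1_norm (fourier_mat_transform (card V) (adjacency_mat V E \<sigma>)) \<le> c * real (card V ^ 2)"
proof -
  let ?n = "card V"
  define a where "a = (\<lambda>\<sigma>. fourier_mat_transform ?n (adjacency_mat V E \<sigma>))"
  define s where "s = (\<lambda>\<sigma>. \<Sum>i<?n. \<Sum>j<?n. (cmod (adjacency_mat V E \<sigma> $$ (i, j)))\<^sup>2)"
  have dim: "dim_row (a \<sigma>) = ?n" "dim_col (a \<sigma>) = ?n" for \<sigma>
    using fourier_mat_transform_carrier[of ?n "adjacency_mat V E \<sigma>"] unfolding a_def by (blast dest: carrier_matD)+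
  have frob: "frobenius_norm (a \<sigma>) = sqrt (s \<sigma>)" for \<sigma>
    using fourier_parseval_mat[OF adjacency_mat_carrier[of V E \<sigma>]]
    by (simp add: frobenius_norm_def dim s_def) (simp add: a_def fourier_mat_transform_def)
  have ratio: "fourier_ratio (adjacency_mat V E \<sigma>) = entrywise_l1_norm (a \<sigma>) / frobenius_norm (a \<sigma>)" for \<sigma>
    by (simp add: fourier_ratio_def a_def fourier_mat_transform_def Let_def adjacency_mat_def)
  \<comment> \<open>With Frobenius norm 0 the quotient has the default value 0 and says nothing
    about the numerator, so this case is treated separately.\<close>
  have zero: "entrywise_l1_norm (a \<sigma>) = 0" if "frobenius_norm (a \<sigma>) = 0" for \<sigma>
    using that by (simp add: frobenius_norm_def entrywise_l1_norm_def dim sum_nonneg sum_nonneg_eq_0_iff)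
  have s_le: "sqrt (s \<sigma>) \<le> real ?n" for \<sigma>
  proof -
    have "s \<sigma> \<le> (\<Sum>i<?n. \<Sum>j<?n. 1)"
      unfolding s_def by (intro sum_mono) (simp add: adjacency_mat_def)
    then show ?thesis by (intro real_le_lsqrt) (simp_all add: power2_eq_square)
  qed
  have "\<exists>\<sigma>\<in>labelings V. frobenius_norm (a \<sigma>) = 0 \<or>
      entrywise_l1_norm (a \<sigma>) / frobenius_norm (a \<sigma>) < c * real ?n"
    using small
  proof
    assume "E = {}"
    then have "frobenius_norm (a \<sigma>) = 0" for \<sigma>
      by (simp add: frob s_def adjacency_mat_def)
    then show ?thesis using labelings_nonempty[OF V] by auto
  next
    assume "edge_complexity V E < c * real ?n"
    moreover have "edge_complexity V E \<in> (\<lambda>\<sigma>. fourier_ratio (adjacency_mat V E \<sigma>)) ` labelings V"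
      unfolding edge_complexity_def
      using labelings_nonempty[OF V] finite_labelings[OF V] by (intro Min_in) auto
    ultimately show ?thesis by (auto simp: ratio)
  qed
  then obtain \<sigma> where \<sigma>: "\<sigma> \<in> labelings V" and alt: "frobenius_norm (a \<sigma>) = 0 \<or>
      entrywise_l1_norm (a \<sigma>) / frobenius_norm (a \<sigma>) < c * real ?n" by blast
  have "entrywise_l1_norm (a \<sigma>) \<le> c * real ?n * frobenius_norm (a \<sigma>)"
  proof (cases "frobenius_norm (a \<sigma>) = 0")
    case False
    moreover have "0 \<le> frobenius_norm (a \<sigma>)"
      by (auto simp: frobenius_norm_def intro!: sum_nonneg)
    ultimately show ?thesis using alt by (simp add: divide_less_eq)
  qed (simp add: zero)
  also have "\<dots> \<le> c * real ?n * real ?n"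
    unfolding frob using s_le c by (intro mult_left_mono) auto
  finally show ?thesis using \<sigma> by (auto simp: a_def power2_eq_square mult_ac)
qed

text \<open>Union bound: the three factors subtracted from 1 bound the number of labelings, the
  number of bad graphs for each labeling, and the mass of a single graph.\<close>

lemma prob_edge_complexity_ge:
  fixes c l p :: real
  assumes p: "0 < p" "p < 1" and c: "0 < c" and l: "ln 2 \<le> l"
  shows "measure_pmf.prob (erdos_renyi N p) {E. E \<noteq> {} \<and> edge_complexity {1..N} E \<ge> c * real N} \<ge>
    1 - real N ^ N * exp ((10 * l * c + 9 * exp (- l)) * real (N ^ 2)) * max p (1 - p) ^ (N choose 2)"
proof -
  let ?M = "erdos_renyi N p"
  let ?G = "{E. E \<noteq> {} \<and> edge_complexity {1..N} E \<ge> c * real N}"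
  let ?X = "exp ((10 * l * c + 9 * exp (- l)) * real (N ^ 2))"
  define B where "B = (\<lambda>\<sigma>. {E. E \<subseteq> {e. e \<subseteq> {1..N} \<and> card e = 2} \<and>
      entrywise_l1_norm (fourier_mat_transform N (adjacency_mat {1..N} E \<sigma>)) \<le> c * real (N ^ 2)})"
  define U where "U = (\<Union>\<sigma>\<in>labelings {1..N}. B \<sigma>)"
  have "U \<subseteq> Pow (possible_edges N)"
    by (auto simp: U_def B_def possible_edges_def)
  then have finU: "finite U" by (rule finite_subset) simp
  have "card U \<le> (\<Sum>\<sigma>\<in>labelings {1..N}. card (B \<sigma>))"
    unfolding U_def by (rule card_UN_le) (simp add: finite_labelings)
  then have "real (card U) \<le> (\<Sum>\<sigma>\<in>labelings {1..N}. real (card (B \<sigma>)))"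
    by (simp flip: of_nat_sum)
  also have "\<dots> \<le> (\<Sum>\<sigma>\<in>labelings {1..N}. ?X)"
    unfolding B_def by (intro sum_mono card_small_fourier_l1_le l) (auto simp: labelings_def)
  also have "\<dots> = real (card (labelings {1..N})) * ?X" by simp
  also have "\<dots> \<le> real N ^ N * ?X"
    using card_labelings_le[of "{1..N}"] by (intro mult_right_mono) (simp_all flip: of_nat_power)
  finally have cardU: "real (card U) \<le> real N ^ N * ?X" .
  \<comment> \<open>The complement also contains sets that are not edge sets on {1..N}; restricting
    to the support discards them.\<close>
  have "measure_pmf.prob ?M (- ?G) = measure_pmf.prob ?M (- ?G \<inter> set_pmf ?M)"
    by (simp add: measure_Int_set_pmf)
  also have "\<dots> \<le> measure_pmf.prob ?M U"
  proof (intro measure_pmf.finite_measure_mono subsetI)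
    fix E assume E: "E \<in> - ?G \<inter> set_pmf ?M"
    then have "E \<subseteq> possible_edges N" using set_pmf_erdos_renyi by blast
    moreover have "E = {} \<or> edge_complexity {1..N} E < c * real (card {1..N})" using E by auto
    ultimately show "E \<in> U"
      using edge_complexity_small_imp[OF _ c, of "{1..N}" E]
      by (auto simp: U_def B_def possible_edges_def)
  qed simp
  also have "\<dots> = (\<Sum>E\<in>U. pmf ?M E)" using finU by (rule measure_measure_pmf_finite)
  also have "\<dots> \<le> real (card U) * max p (1 - p) ^ (N choose 2)"
    by (rule sum_bounded_above) (rule pmf_erdos_renyi_le[OF p])
  also have "\<dots> \<le> real N ^ N * ?X * max p (1 - p) ^ (N choose 2)"
    using cardU p by (intro mult_right_mono) auto
  finally have "measure_pmf.prob ?M (- ?G) \<le> real N ^ N * ?X * max p (1 - p) ^ (N choose 2)" .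
  moreover have "measure_pmf.prob ?M (- ?G) = 1 - measure_pmf.prob ?M ?G"
    using measure_pmf.prob_compl[of ?G ?M] by (simp add: Compl_eq_Diff_UNIV)
  ultimately show ?thesis by linarith
qed

theorem corollary5p2:
  fixes p :: real
  assumes "0 < p" and "p < 1"
  shows "\<exists>c>0. (\<lambda>N. measure_pmf.prob (erdos_renyi N p)
             {E. E \<noteq> {} \<and> edge_complexity {1..N} E \<ge> c * real N}) \<longlonglongrightarrow> 1"
proof -
  \<comment> \<open>A single graph has mass at most exp(-\<rho>N(N-1)/2), so a count of
    exp(\<rho>N^2/4) is affordable. Half of this exponent is reserved for the term with exp(-l),
    which fixes \<open>l\<close>, and half for 10lc, which then fixes \<open>c\<close>.\<close>
  define \<rho> where "\<rho> = - ln (max p (1 - p))"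
  have \<rho>: "\<rho> > 0" using assms by (simp add: \<rho>_def)
  have r: "max p (1 - p) = exp (- \<rho>)" using assms by (simp add: \<rho>_def)
  define l where "l = max (ln 2) (ln (72 / \<rho>))"
  have l: "ln 2 \<le> l" and l0: "0 < l"
    using ln_gt_zero[of "2::real"] by (auto simp: l_def less_max_iff_disj)
  have "exp (- l) \<le> exp (- ln (72 / \<rho>))" by (simp add: l_def)
  then have el: "9 * exp (- l) \<le> \<rho> / 8" using \<rho> by (simp add: exp_minus)
  define c where "c = \<rho> / (80 * l)"
  have c: "0 < c" using \<rho> l0 by (simp add: c_def)
  have cl: "10 * l * c = \<rho> / 8" using l0 by (simp add: c_def)
  let ?prob = "\<lambda>N. measure_pmf.prob (erdos_renyi N p) {E. E \<noteq> {} \<and> edge_complexity {1..N} E \<ge> c * real N}"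
  have lower: "1 - exp (real N * ln (real N) + \<rho> / 4 * real N ^ 2 - \<rho> * (real N * (real N - 1) / 2)) \<le> ?prob N"
    if "N > 0" for N
  proof -
    have "real (N choose 2) = real N * (real N - 1) / 2"
      using that by (simp add: choose_two real_of_nat_div of_nat_diff)
    then have "max p (1 - p) ^ (N choose 2) = exp (- \<rho> * (real N * (real N - 1) / 2))"
      unfolding r by (simp add: exp_of_nat_mult[symmetric] mult_ac)
    moreover have "real N ^ N = exp (real N * ln (real N))"
      using that by (simp add: exp_of_nat_mult)
    moreover have "exp ((10 * l * c + 9 * exp (- l)) * real (N ^ 2)) \<le> exp (\<rho> / 4 * real N ^ 2)"
    proof -
      have "10 * l * c + 9 * exp (- l) \<le> \<rho> / 4" using el unfolding cl by linarith
      then have "(10 * l * c + 9 * exp (- l)) * real N ^ 2 \<le> \<rho> / 4 * real N ^ 2"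
        by (rule mult_right_mono) simp
      then show ?thesis by simp
    qed
    ultimately have "real N ^ N * exp ((10 * l * c + 9 * exp (- l)) * real (N ^ 2)) * max p (1 - p) ^ (N choose 2)
        \<le> exp (real N * ln (real N)) * exp (\<rho> / 4 * real N ^ 2) * exp (- \<rho> * (real N * (real N - 1) / 2))"
      by simp
    also have "\<dots> = exp (real N * ln (real N) + \<rho> / 4 * real N ^ 2 - \<rho> * (real N * (real N - 1) / 2))"
      by (simp flip: exp_add)
    finally show ?thesis using prob_edge_complexity_ge[OF assms c l, of N] by linarith
  qed
  \<comment> \<open>The exponent is -\<rho>N^2/4 + N ln N + \<rho>N/2: the labelings cost only N ln
    N, and the quadratic term wins.\<close>
  have lim: "(\<lambda>N. 1 - exp (real N * ln (real N) + \<rho> / 4 * real N ^ 2 - \<rho> * (real N * (real N - 1) / 2))) \<longlonglongrightarrow> 1"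
    using \<rho> by real_asymp
  have "?prob \<longlonglongrightarrow> 1"
  proof (rule tendsto_sandwich[OF _ _ lim tendsto_const])
    show "\<forall>\<^sub>F N in sequentially. 1 - exp (real N * ln (real N) + \<rho> / 4 * real N ^ 2 - \<rho> * (real N * (real N - 1) / 2)) \<le> ?prob N"
      using eventually_gt_at_top[of 0] by eventually_elim (rule lower)
  qed simp
  then show ?thesis using c by blast
qed

end
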